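(* Let $P=\frac15P_1+\frac45P_2$, where $P_1$ and $P_2$ are the uniform distributions on $[0,1]$ and $[1,2]$, respectively. The optimal set of two-means for $P$ is $\{\frac{11}{16},\frac{25}{16}\}$, with quantization error $V_2=\frac{317}{3840}$.
   Context: For a Borel probability measure $P$ on $\mathbb{R}$ and $n\in\mathbb{N}$, the $n$th quantization error is $V_n=V_n(P)=\inf\{\int\min_{a\in\alpha}(x-a)^2\,dP(x) : \alpha\subset\mathbb{R},\ 1\le\mathrm{card}(\alpha)\le n\}$, and an optimal set of $n$-means for $P$ is a set $\alpha$ with $1\le\mathrm{card}(\alpha)\le n$ attaining this infimum. *)

theory Defs
  imports "HOL-Probability.Probability"
begin

definition mixture :: "real \<Rightarrow> 'a measure \<Rightarrow> 'a measure \<Rightarrow> 'a measure" where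
  "mixture p M N =
     measure_of (space M) (sets M)
       (\<lambda>A. ennreal p * emeasure M A + ennreal (1 - p) * emeasure N A)"

lemma space_mixture [simp]: "space (mixture p M N) = space M"
  by (simp add: mixture_def space_measure_of_conv)

lemma sets_mixture [simp, measurable_cong]: "sets (mixture p M N) = sets M"
  by (simp add: mixture_def)

lemma emeasure_mixture:
  assumes "sets N = sets M" and "A \<in> sets M"
  shows "emeasure (mixture p M N) A =
           ennreal p * emeasure M A + ennreal (1 - p) * emeasure N A"
  unfolding mixture_def
proof (rule emeasure_measure_of_sigma)
  show "sigma_algebra (space M) (sets M)" ..
  show "positive (sets M) (\<lambda>A. ennreal p * emeasure M A + ennreal (1 - p) * emeasure N A)"
    by (simp add: positive_def)
  show "countably_additive (sets M)
          (\<lambda>A. ennreal p * emeasure M A + ennreal (1 - p) * emeasure N A)"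
  proof (rule countably_additiveI)
    fix F :: "nat \<Rightarrow> 'a set"
    assume "range F \<subseteq> sets M" and "disjoint_family F"
    then show "(\<Sum>i. ennreal p * emeasure M (F i) + ennreal (1 - p) * emeasure N (F i)) =
        ennreal p * emeasure M (\<Union> (range F)) + ennreal (1 - p) * emeasure N (\<Union> (range F))"
      using assms(1) by (simp add: suminf_add [symmetric] suminf_emeasure)
  qed
qed (fact assms(2))

lemma prob_space_mixture:
  assumes "prob_space M" "prob_space N" "sets N = sets M" "0 \<le> p" "p \<le> 1"
  shows "prob_space (mixture p M N)"
proof
  have "space N = space M"
    using assms(3) by (rule sets_eq_imp_space_eq)
  then have "emeasure (mixture p M N) (space M) = ennreal p + ennreal (1 - p)"
    using assms(1-3) prob_space.emeasure_space_1 [of M] prob_space.emeasure_space_1 [of N]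
    by (simp add: emeasure_mixture)
  also have "\<dots> = 1"
    using assms(4,5) by (simp flip: ennreal_plus)
  finally show "emeasure (mixture p M N) (space (mixture p M N)) = 1"
    by simp
qed

text \<open>
  The distortion is a nonnegative Lebesgue integral, so that it is infinite, rather than
  the default value 0 of the Bochner integral, when the second moment does not exist.
\<close>
definition distortion :: "real measure \<Rightarrow> real set \<Rightarrow> ennreal" where
  "distortion P \<alpha> = (\<integral>\<^sup>+ x. ennreal (Min ((\<lambda>a. (x - a)\<^sup>2) ` \<alpha>)) \<partial>P)"

text \<open>Infinite sets have \<^const>\<open>card\<close> 0, so the lower bound also enforces finiteness.\<close>
definition codebooks :: "nat \<Rightarrow> real set set" where
  "codebooks n = {\<alpha>. 1 \<le> card \<alpha> \<and> card \<alpha> \<le> n}"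

definition quantization_error :: "real measure \<Rightarrow> nat \<Rightarrow> ennreal" where
  "quantization_error P n = (INF \<alpha>\<in>codebooks n. distortion P \<alpha>)"

definition optimal_set_of_means :: "real measure \<Rightarrow> nat \<Rightarrow> real set \<Rightarrow> bool" where
  "optimal_set_of_means P n \<alpha> \<longleftrightarrow>
     \<alpha> \<in> codebooks n \<and> distortion P \<alpha> = quantization_error P n"

definition mixed_uniform :: "real measure" where
  "mixed_uniform =
     mixture (1/5) (uniform_measure lborel {0..1}) (uniform_measure lborel {1..2})"

lemma sets_mixed_uniform [simp, measurable_cong]: "sets mixed_uniform = sets borel"
  by (simp add: mixed_uniform_def)

lemma emeasure_mixed_uniform:
  assumes "A \<in> sets borel"
  shows "emeasure mixed_uniform A =
           ennreal (1/5) * emeasure (uniform_measure lborel {0..1}) A +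
           ennreal (4/5) * emeasure (uniform_measure lborel {1..2}) A"
  using assms by (simp add: mixed_uniform_def emeasure_mixture)

lemma prob_space_mixed_uniform: "prob_space mixed_uniform"
  unfolding mixed_uniform_def
  by (intro prob_space_mixture prob_space_uniform_measure) auto

end

theory Submission
  imports Defs
begin

text \<open>
  A codebook with at most two points is \<open>{a, b}\<close> with \<open>a \<le> b\<close>. A point of \<open>[0, 2]\<close> is
  quantized to \<open>a\<close> or to \<open>b\<close> according to the side of the midpoint \<open>(a + b) / 2\<close> on which it
  lies, so the distortion is a sum of integrals of \<open>(x - a)\<^sup>2\<close> up to a threshold \<open>t\<close> and of
  \<open>(x - b)\<^sup>2\<close> from there on, where \<open>t\<close> is the midpoint clamped to \<open>[0, 2]\<close>
  (\<open>distortion_mixed_uniform_pair\<close>).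

  The proof then forgets how \<open>t\<close> depends on \<open>a\<close> and \<open>b\<close>. For a fixed threshold, completing
  squares writes the cost as the mass of each cell times the squared distance of its code point
  from the conditional mean of the cell, plus a rational function of \<open>t\<close> alone. This remainder
  exceeds \<open>317/3840\<close> for \<open>t \<le> 1\<close> (\<open>cost_split_left\<close>). For \<open>t \<ge> 1\<close> it exceeds \<open>317/3840\<close> by
  a multiple of \<open>(8 * t - 9)\<^sup>2\<close> with a positive factor (\<open>cost_split_right\<close>), and so the minimum
  occurs only for \<open>t = 9/8\<close> with \<open>a\<close> and \<open>b\<close> equal to the conditional means \<open>11/16\<close> and
  \<open>25/16\<close> of the two cells. The midpoint of these is again \<open>9/8\<close>, so the bound is attained.
\<close>

lemma nn_integral_mixture:
  assumes N: "sets N = sets M" and f: "f \<in> borel_measurable M"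
  shows "(\<integral>\<^sup>+ x. f x \<partial>mixture p M N) =
           ennreal p * (\<integral>\<^sup>+ x. f x \<partial>M) + ennreal (1 - p) * (\<integral>\<^sup>+ x. f x \<partial>N)"
  using f
proof (induction rule: borel_measurable_induct)
  case (cong f g)
  have "space N = space M"
    using N by (rule sets_eq_imp_space_eq)
  with cong have "(\<integral>\<^sup>+ x. f x \<partial>K) = (\<integral>\<^sup>+ x. g x \<partial>K)" if "space K = space M" for K
    using that by (intro nn_integral_cong) simp
  with cong \<open>space N = space M\<close> show ?case
    by simp
next
  case (set A)
  then show ?case
    using N by (simp add: emeasure_mixture)
next
  case (mult u c)
  moreover have "u \<in> borel_measurable N" "u \<in> borel_measurable (mixture p M N)"
    using mult N by (simp_all cong: measurable_cong_sets)
  ultimately show ?case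
    by (simp add: nn_integral_cmult algebra_simps)
next
  case (add u v)
  moreover have "u \<in> borel_measurable N" "u \<in> borel_measurable (mixture p M N)"
      "v \<in> borel_measurable N" "v \<in> borel_measurable (mixture p M N)"
    using add N by (simp_all cong: measurable_cong_sets)
  ultimately show ?case
    by (simp add: nn_integral_add algebra_simps)
next
  case (seq U)
  have U: "U i \<in> borel_measurable N" "U i \<in> borel_measurable (mixture p M N)" for i
    using seq N by (simp_all cong: measurable_cong_sets)
  have mono: "incseq (\<lambda>i. c * (\<integral>\<^sup>+ x. U i x \<partial>K))" for K and c :: ennreal
    using \<open>incseq U\<close>
    by (auto intro!: mult_left_mono nn_integral_mono simp: incseq_def le_fun_def)
  have "(\<integral>\<^sup>+ x. (SUP i. U i) x \<partial>mixture p M N) = (SUP i. \<integral>\<^sup>+ x. U i x \<partial>mixture p M N)"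
    using U seq by (simp add: nn_integral_monotone_convergence_SUP image_comp)
  also have "\<dots> = (SUP i. ennreal p * (\<integral>\<^sup>+ x. U i x \<partial>M) + ennreal (1 - p) * (\<integral>\<^sup>+ x. U i x \<partial>N))"
    by (simp add: seq)
  also have "\<dots> = (SUP i. ennreal p * (\<integral>\<^sup>+ x. U i x \<partial>M)) + (SUP i. ennreal (1 - p) * (\<integral>\<^sup>+ x. U i x \<partial>N))"
    by (intro ennreal_SUP_add mono)
  also have "\<dots> = ennreal p * (\<integral>\<^sup>+ x. (SUP i. U i) x \<partial>M) + ennreal (1 - p) * (\<integral>\<^sup>+ x. (SUP i. U i) x \<partial>N)"
    using U seq
    by (simp add: nn_integral_monotone_convergence_SUP SUP_mult_left_ennreal [symmetric] image_comp)
  finally show ?case .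
qed

text \<open>The integral of \<open>(x - c)\<^sup>2\<close> over \<open>[u, v]\<close>, in closed form.\<close>
definition interval_cost :: "real \<Rightarrow> real \<Rightarrow> real \<Rightarrow> real" where
  "interval_cost u v c = ((v - c) ^ 3 - (u - c) ^ 3) / 3"

lemma interval_cost_nonneg: "u \<le> v \<Longrightarrow> 0 \<le> interval_cost u v c"
  by (simp add: interval_cost_def power_mono_odd)

lemma interval_cost_empty [simp]: "interval_cost u u c = 0"
  by (simp add: interval_cost_def)

lemma nn_integral_square_interval:
  assumes "u \<le> v"
  shows "(\<integral>\<^sup>+ x. ennreal ((x - c)\<^sup>2) * indicator {u..v} x \<partial>lborel) = ennreal (interval_cost u v c)"
proof -
  have "(\<integral>\<^sup>+ x. ennreal ((x - c)\<^sup>2) * indicator {u..v} x \<partial>lborel) =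
          ennreal ((v - c) ^ 3 / 3 - (u - c) ^ 3 / 3)"
    using assms
    by (intro nn_integral_FTC_Icc) (auto intro!: derivative_eq_intros)
  then show ?thesis
    by (simp add: interval_cost_def diff_divide_distrib)
qed

text \<open>
  Clamping the midpoint to \<open>[u, v]\<close> covers uniformly the cases in which one of the two code
  points serves the whole interval.
\<close>
lemma nn_integral_min_square_interval:
  fixes a b u v :: real
  assumes "a \<le> b" "u \<le> v"
  defines "t \<equiv> max u (min v ((a + b) / 2))"
  shows "(\<integral>\<^sup>+ x. ennreal (min ((x - a)\<^sup>2) ((x - b)\<^sup>2)) * indicator {u..v} x \<partial>lborel) =
           ennreal (interval_cost u t a + interval_cost t v b)"
proof -
  have t: "u \<le> t" "t \<le> v"
    using assms(2) by (auto simp: t_def)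
  have sq: "(x - b)\<^sup>2 - (x - a)\<^sup>2 = 2 * (b - a) * ((a + b) / 2 - x)" for x
    by (simp add: power2_eq_square field_simps)
  have a_nearer: "min ((x - a)\<^sup>2) ((x - b)\<^sup>2) = (x - a)\<^sup>2" if "x \<le> (a + b) / 2" for x
  proof -
    have "0 \<le> (x - b)\<^sup>2 - (x - a)\<^sup>2"
      unfolding sq using that \<open>a \<le> b\<close> by (intro mult_nonneg_nonneg) auto
    then show ?thesis
      by simp
  qed
  have b_nearer: "min ((x - a)\<^sup>2) ((x - b)\<^sup>2) = (x - b)\<^sup>2" if "x \<ge> (a + b) / 2" for x
  proof -
    have "(x - b)\<^sup>2 - (x - a)\<^sup>2 \<le> 0"
      unfolding sq using that \<open>a \<le> b\<close> by (intro mult_nonneg_nonpos) auto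
    then show ?thesis
      by simp
  qed
  (* Both closed pieces contain t, so the splitting below counts this point twice. *)
  have "AE x in lborel. x \<noteq> t"
    by (rule AE_lborel_singleton)
  then have "AE x in lborel. ennreal (min ((x - a)\<^sup>2) ((x - b)\<^sup>2)) * indicator {u..v} x =
      ennreal ((x - a)\<^sup>2) * indicator {u..t} x + ennreal ((x - b)\<^sup>2) * indicator {t..v} x"
  proof eventually_elim
    case (elim x)
    consider "x < u" | "v < x" | "u \<le> x" "x < t" | "t < x" "x \<le> v"
      using elim by linarith
    then show ?case
    proof cases
      case 3
      then have "x \<le> (a + b) / 2"
        by (simp add: t_def less_max_iff_disj)
      with 3 t show ?thesis
        by (simp add: a_nearer)
    next
      case 4
      then have "x \<ge> (a + b) / 2"
        by (simp add: t_def min_less_iff_disj)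
      with 4 t show ?thesis
        by (simp add: b_nearer)
    qed (use t in auto)
  qed
  then have "(\<integral>\<^sup>+ x. ennreal (min ((x - a)\<^sup>2) ((x - b)\<^sup>2)) * indicator {u..v} x \<partial>lborel) =
      (\<integral>\<^sup>+ x. ennreal ((x - a)\<^sup>2) * indicator {u..t} x + ennreal ((x - b)\<^sup>2) * indicator {t..v} x \<partial>lborel)"
    by (rule nn_integral_cong_AE)
  also have "\<dots> = ennreal (interval_cost u t a) + ennreal (interval_cost t v b)"
    using t by (subst nn_integral_add) (simp_all add: nn_integral_square_interval)
  finally show ?thesis
    using t by (simp add: interval_cost_nonneg)
qed

text \<open>
  The midpoint is clamped separately to the two intervals on which the density is constant. One
  of \<open>r\<close> and \<open>s\<close> is therefore the common endpoint 1, and the other is the actual threshold.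
\<close>
definition pair_cost :: "real \<Rightarrow> real \<Rightarrow> real" where
  "pair_cost a b =
     (let r = max 0 (min 1 ((a + b) / 2)); s = max 1 (min 2 ((a + b) / 2))
      in 1/5 * (interval_cost 0 r a + interval_cost r 1 b) +
         4/5 * (interval_cost 1 s a + interval_cost s 2 b))"

lemma pair_cost_nonneg: "0 \<le> pair_cost a b"
  unfolding pair_cost_def Let_def
  by (intro add_nonneg_nonneg mult_nonneg_nonneg interval_cost_nonneg) auto

lemma distortion_mixed_uniform_pair:
  assumes "a \<le> b"
  shows "distortion mixed_uniform {a, b} = ennreal (pair_cost a b)"
proof -
  define f where "f x = ennreal (min ((x - a)\<^sup>2) ((x - b)\<^sup>2))" for x :: real
  define r where "r = max 0 (min 1 ((a + b) / 2))"
  define s where "s = max 1 (min 2 ((a + b) / 2))"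
  have [measurable]: "f \<in> borel_measurable borel"
    unfolding f_def by measurable
  have f1: "(\<integral>\<^sup>+ x. f x \<partial>uniform_measure lborel {0..1}) =
      ennreal (interval_cost 0 r a + interval_cost r 1 b)"
    using nn_integral_min_square_interval [OF assms, of 0 1]
    by (simp add: nn_integral_uniform_measure f_def r_def divide_ennreal_def)
  have f2: "(\<integral>\<^sup>+ x. f x \<partial>uniform_measure lborel {1..2}) =
      ennreal (interval_cost 1 s a + interval_cost s 2 b)"
    using nn_integral_min_square_interval [OF assms, of 1 2]
    by (simp add: nn_integral_uniform_measure f_def s_def divide_ennreal_def)
  have nonneg: "0 \<le> interval_cost 0 r a + interval_cost r 1 b"
      "0 \<le> interval_cost 1 s a + interval_cost s 2 b"
    by (auto intro!: add_nonneg_nonneg interval_cost_nonneg simp: r_def s_def)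
  have "distortion mixed_uniform {a, b} = (\<integral>\<^sup>+ x. f x \<partial>mixed_uniform)"
    by (simp add: distortion_def f_def)
  also have "\<dots> = ennreal (1/5) * ennreal (interval_cost 0 r a + interval_cost r 1 b) +
      ennreal (1 - 1/5) * ennreal (interval_cost 1 s a + interval_cost s 2 b)"
    unfolding mixed_uniform_def by (subst nn_integral_mixture) (simp_all only: f1 f2, simp_all)
  also have "\<dots> = ennreal (1/5 * (interval_cost 0 r a + interval_cost r 1 b) +
      4/5 * (interval_cost 1 s a + interval_cost s 2 b))"
    using nonneg by (simp add: ennreal_mult' [symmetric] ennreal_plus [symmetric] del: ennreal_plus)
  finally show ?thesis
    by (simp add: pair_cost_def Let_def r_def s_def)
qed

text \<open>
  The next two lemmas keep the denominator out of the polynomial identities for the cost. In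
  their uses \<open>w / 5\<close> is the mass of a cell and \<open>q / (2 * w)\<close> its conditional mean; the term
  \<open>q\<^sup>2 / (20 * w)\<close> left by completing the square turns into a polynomial once the remainder,
  which has the denominator \<open>1280 * w\<close>, is added to it.
\<close>
lemma complete_square_weighted:
  fixes w y q :: real
  assumes "w \<noteq> 0"
  shows "w / 5 * (y - q / (2 * w))\<^sup>2 = w / 5 * y\<^sup>2 - y * q / 5 + q\<^sup>2 / (20 * w)"
proof -
  have "w / 5 * (y - q / (2 * w))\<^sup>2 =
      w / 5 * y\<^sup>2 - w / 5 * (2 * y * (q / (2 * w))) + w / 5 * (q / (2 * w))\<^sup>2"
    by (simp only: power2_diff right_diff_distrib distrib_left)
  moreover have "w / 5 * (2 * y * (q / (2 * w))) = y * q / 5"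
      "w / 5 * (q / (2 * w))\<^sup>2 = q\<^sup>2 / (20 * w)"
    using assms by (simp_all add: power2_eq_square)
  ultimately show ?thesis
    by simp
qed

lemma add_fractions_cancel:
  fixes w x y z :: real
  assumes "w \<noteq> 0" and "64 * x + y = z * w"
  shows "x / (20 * w) + y / (1280 * w) = z / 1280"
proof -
  have "x / (20 * w) + y / (1280 * w) = (64 * x + y) / (1280 * w)"
    using assms(1) by (simp add: field_simps)
  then show ?thesis
    using assms by simp
qed

text \<open>
  The cells \<open>[0, t]\<close> and \<open>[t, 2]\<close> have masses \<open>t / 5\<close> and \<open>(5 - t) / 5\<close> and conditional means
  \<open>t / 2\<close> and \<open>(13 - t\<^sup>2) / (2 * (5 - t))\<close>. Expanding the remainder in powers of \<open>1 - t\<close> makes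
  its sign visible.
\<close>
lemma cost_split_left:
  fixes a b t :: real
  assumes "t \<le> 1"
  shows "1/5 * (interval_cost 0 t a + interval_cost t 1 b) + 4/5 * interval_cost 1 2 b - 317/3840 =
           t / 5 * (a - t / 2)\<^sup>2 + (5 - t) / 5 * (b - (13 - t\<^sup>2) / (2 * (5 - t)))\<^sup>2 +
           (4 + (1 - t) + 704 * (1 - t)\<^sup>2 + 320 * (1 - t) ^ 3) / (1280 * (5 - t))"
proof -
  let ?rem = "4 + (1 - t) + 704 * (1 - t)\<^sup>2 + 320 * (1 - t) ^ 3"
  have w: "5 - t \<noteq> 0"
    using assms by simp
  (* 2369 / 1280 = 29 / 15 - 317 / 3840, where 29 / 15 is the second moment. *)
  have "64 * (13 - t\<^sup>2)\<^sup>2 + ?rem = (2369 - 64 * t ^ 3) * (5 - t)"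
    by algebra
  then have rem: "(13 - t\<^sup>2)\<^sup>2 / (20 * (5 - t)) + ?rem / (1280 * (5 - t)) = (2369 - 64 * t ^ 3) / 1280"
    by (rule add_fractions_cancel [OF w])
  have "1/5 * (interval_cost 0 t a + interval_cost t 1 b) + 4/5 * interval_cost 1 2 b - 317/3840 =
      t / 5 * (a - t / 2)\<^sup>2 + ((5 - t) / 5 * b\<^sup>2 - b * (13 - t\<^sup>2) / 5) + (2369 - 64 * t ^ 3) / 1280"
    by (simp add: interval_cost_def field_simps power2_eq_square power3_eq_cube)
  then show ?thesis
    unfolding rem [symmetric] complete_square_weighted [OF w] by simp
qed

text \<open>
  The cells \<open>[0, t]\<close> and \<open>[t, 2]\<close> have masses \<open>(4 * t - 3) / 5\<close> and \<open>4 * (2 - t) / 5\<close> and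
  conditional means \<open>(4 * t\<^sup>2 - 3) / (2 * (4 * t - 3))\<close> and \<open>(t + 2) / 2\<close>. The threshold is the
  midpoint of these means for \<open>t = 1\<close> and \<open>t = 9/8\<close>; the remainder has its double zero at
  the latter.
\<close>
lemma cost_split_right:
  fixes a b t :: real
  assumes "1 \<le> t"
  shows "1/5 * interval_cost 0 1 a + 4/5 * (interval_cost 1 t a + interval_cost t 2 b) - 317/3840 =
           (4 * t - 3) / 5 * (a - (4 * t\<^sup>2 - 3) / (2 * (4 * t - 3)))\<^sup>2 +
           4 * (2 - t) / 5 * (b - (t + 2) / 2)\<^sup>2 +
           (8 * t - 9)\<^sup>2 * (20 * t - 19) / (1280 * (4 * t - 3))"
proof -
  let ?rem = "(8 * t - 9)\<^sup>2 * (20 * t - 19)"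
  have w: "4 * t - 3 \<noteq> 0"
    using assms by simp
  have "64 * (4 * t\<^sup>2 - 3)\<^sup>2 + ?rem = (2369 - 256 * ((2 - t) * (t + 2)\<^sup>2)) * (4 * t - 3)"
    by algebra
  then have rem: "(4 * t\<^sup>2 - 3)\<^sup>2 / (20 * (4 * t - 3)) + ?rem / (1280 * (4 * t - 3)) =
      (2369 - 256 * ((2 - t) * (t + 2)\<^sup>2)) / 1280"
    by (rule add_fractions_cancel [OF w])
  have "1/5 * interval_cost 0 1 a + 4/5 * (interval_cost 1 t a + interval_cost t 2 b) - 317/3840 =
      ((4 * t - 3) / 5 * a\<^sup>2 - a * (4 * t\<^sup>2 - 3) / 5) + 4 * (2 - t) / 5 * (b - (t + 2) / 2)\<^sup>2 +
      (2369 - 256 * ((2 - t) * (t + 2)\<^sup>2)) / 1280"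
    by (simp add: interval_cost_def field_simps power2_eq_square power3_eq_cube)
  then show ?thesis
    unfolding rem [symmetric] complete_square_weighted [OF w] by simp
qed

lemma pair_cost_lower_bound:
  assumes "a \<le> b"
  shows "317/3840 \<le> pair_cost a b"
    and "pair_cost a b = 317/3840 \<Longrightarrow> a = 11/16 \<and> b = 25/16"
proof -
  have "317/3840 \<le> pair_cost a b \<and> (pair_cost a b = 317/3840 \<longrightarrow> a = 11/16 \<and> b = 25/16)"
  proof (cases "(a + b) / 2 \<le> 1")
    case True
    define t where "t = max 0 ((a + b) / 2)"
    have t: "0 \<le> t" "t \<le> 1"
      using True by (auto simp: t_def)
    have "pair_cost a b =
        1/5 * (interval_cost 0 t a + interval_cost t 1 b) + 4/5 * interval_cost 1 2 b"
      using True by (simp add: pair_cost_def Let_def t_def min_absorb2 max_absorb1)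
    then have eq: "pair_cost a b - 317/3840 =
        t / 5 * (a - t / 2)\<^sup>2 + (5 - t) / 5 * (b - (13 - t\<^sup>2) / (2 * (5 - t)))\<^sup>2 +
        (4 + (1 - t) + 704 * (1 - t)\<^sup>2 + 320 * (1 - t) ^ 3) / (1280 * (5 - t))"
      using cost_split_left [OF t(2)] by simp
    have "0 \<le> t / 5 * (a - t / 2)\<^sup>2" "0 \<le> (5 - t) / 5 * (b - (13 - t\<^sup>2) / (2 * (5 - t)))\<^sup>2"
      using t by simp_all
    moreover have "0 < (4 + (1 - t) + 704 * (1 - t)\<^sup>2 + 320 * (1 - t) ^ 3) / (1280 * (5 - t))"
      using t by (intro divide_pos_pos add_pos_nonneg) auto
    ultimately show ?thesis
      using eq by linarith
  next
    case False
    define t where "t = min 2 ((a + b) / 2)"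
    have t: "1 \<le> t" "t \<le> 2"
      using False by (auto simp: t_def)
    let ?m = "(4 * t\<^sup>2 - 3) / (2 * (4 * t - 3))"
    have "pair_cost a b =
        1/5 * interval_cost 0 1 a + 4/5 * (interval_cost 1 t a + interval_cost t 2 b)"
      using False by (simp add: pair_cost_def Let_def t_def min_absorb1 max_absorb2)
    then have eq: "pair_cost a b - 317/3840 =
        (4 * t - 3) / 5 * (a - ?m)\<^sup>2 + 4 * (2 - t) / 5 * (b - (t + 2) / 2)\<^sup>2 +
        (8 * t - 9)\<^sup>2 * (20 * t - 19) / (1280 * (4 * t - 3))"
      using cost_split_right [OF t(1)] by simp
    have nonneg: "0 \<le> (4 * t - 3) / 5 * (a - ?m)\<^sup>2" "0 \<le> 4 * (2 - t) / 5 * (b - (t + 2) / 2)\<^sup>2"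
        "0 \<le> (8 * t - 9)\<^sup>2 * (20 * t - 19) / (1280 * (4 * t - 3))"
      using t by simp_all
    have "a = 11/16 \<and> b = 25/16" if "pair_cost a b = 317/3840"
    proof -
      have zero: "(4 * t - 3) / 5 * (a - ?m)\<^sup>2 = 0" "4 * (2 - t) / 5 * (b - (t + 2) / 2)\<^sup>2 = 0"
          "(8 * t - 9)\<^sup>2 * (20 * t - 19) / (1280 * (4 * t - 3)) = 0"
        using eq nonneg that by linarith+
      have "t = 9/8"
        using zero(3) t by auto
      with zero(1,2) show ?thesis
        by (simp add: power2_eq_square)
    qed
    with eq nonneg show ?thesis
      by linarith
  qed
  then show "317/3840 \<le> pair_cost a b"
    and "pair_cost a b = 317/3840 \<Longrightarrow> a = 11/16 \<and> b = 25/16"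
    by blast+
qed

lemma pair_cost_optimum: "pair_cost (11/16) (25/16) = 317/3840"
  by (simp add: pair_cost_def Let_def interval_cost_def power3_eq_cube)

text \<open>A singleton is represented with \<open>a = b\<close>.\<close>
lemma codebooks_two_cases:
  assumes "\<alpha> \<in> codebooks 2"
  obtains a b where "a \<le> b" "\<alpha> = {a, b}"
proof -
  have "card \<alpha> = 1 \<or> card \<alpha> = 2"
    using assms by (auto simp: codebooks_def)
  then obtain a b where "\<alpha> = {a, b}"
    by (auto simp: card_1_singleton_iff card_2_iff)
  then show thesis
    using that [of a b] that [of b a] by (cases "a \<le> b") (auto simp: insert_commute)
qed

theorem proposition2p8p1:
  shows "(\<forall>\<alpha>. optimal_set_of_means mixed_uniform 2 \<alpha> \<longleftrightarrow> \<alpha> = {11/16, 25/16}) \<and>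
         quantization_error mixed_uniform 2 = ennreal (317/3840)"
proof -
  have attained: "distortion mixed_uniform {11/16, 25/16} = ennreal (317/3840)"
    by (simp add: distortion_mixed_uniform_pair pair_cost_optimum)
  have codebook: "{11/16, 25/16} \<in> codebooks 2"
    by (simp add: codebooks_def)
  have error: "quantization_error mixed_uniform 2 = ennreal (317/3840)"
    unfolding quantization_error_def
  proof (rule antisym)
    show "(INF \<alpha>\<in>codebooks 2. distortion mixed_uniform \<alpha>) \<le> ennreal (317/3840)"
      using INF_lower [OF codebook, of "distortion mixed_uniform"] attained by simp
    show "ennreal (317/3840) \<le> (INF \<alpha>\<in>codebooks 2. distortion mixed_uniform \<alpha>)"
    proof (rule INF_greatest)
      fix \<alpha> assume "\<alpha> \<in> codebooks 2"
      then obtain a b where "a \<le> b" "\<alpha> = {a, b}"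
        by (rule codebooks_two_cases)
      then show "ennreal (317/3840) \<le> distortion mixed_uniform \<alpha>"
        by (simp only: distortion_mixed_uniform_pair pair_cost_lower_bound ennreal_leI)
    qed
  qed
  have "\<alpha> = {11/16, 25/16}" if "optimal_set_of_means mixed_uniform 2 \<alpha>" for \<alpha>
  proof -
    have "\<alpha> \<in> codebooks 2" and opt: "distortion mixed_uniform \<alpha> = ennreal (317/3840)"
      using that error by (simp_all add: optimal_set_of_means_def)
    then obtain a b where ab: "a \<le> b" "\<alpha> = {a, b}"
      by (auto elim: codebooks_two_cases)
    with opt have "ennreal (pair_cost a b) = ennreal (317/3840)"
      by (simp only: distortion_mixed_uniform_pair)
    then have "pair_cost a b = 317/3840"
      by (subst (asm) ennreal_inj) (simp_all add: pair_cost_nonneg)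
    with ab show ?thesis
      using pair_cost_lower_bound(2) by blast
  qed
  moreover have "optimal_set_of_means mixed_uniform 2 {11/16, 25/16}"
    using codebook by (simp only: optimal_set_of_means_def attained error)
  ultimately show ?thesis
    using error by blast
qed

end
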